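(* Let $X$ be a compact Hausdorff space, let $(P,f)$ be any cover of $X$ with $P$ projective, and let $C\subseteq P$ be a compact subset that is minimal (with respect to inclusion) among all compact subsets $C$ of $P$ satisfying $f(C)=X$. Then $(C,f)$ (with $f$ restricted to $C$) is a rigid cover and an essential cover of $X$, and $C$ is projective. Moreover, if $(C',f')$ is a cover of $X$ such that $C'$ is projective and $(C',f')$ is either rigid or essential, then there exists a homeomorphism $h:C\to C'$ such that $f'(h(c))=f(c)$ for every $c\in C$.
   Context: A compact Hausdorff space $P$ is projective if for all compact Hausdorff spaces $X,Y$ and continuous maps $h:Y\to X$ and $f:P\to X$ with $h$ onto, there exists a continuous map $r:P\to Y$ with $h\circ r=f$. Let $X$ be a compact Hausdorff space. A pair $(C,f)$ is a cover of $X$ if $C$ is a compact Hausdorff space and $f:C\to X$ is a continuous map onto $X$. A cover $(C,f)$ is an essential cover of $X$ if whenever $Y$ is a compact Hausdorff space, $h:Y\to C$ is continuous and $f(h(Y))=X$, then $h(Y)=C$. A cover $(C,f)$ is a rigid cover of $X$ if the only continuous map $h:C\to C$ satisfying $f(h(c))=f(c)$ for every $c\in C$ is the identity map. *)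

theory Defs
  imports "HOL-Analysis.Analysis"
begin

abbreviation compact_Hausdorff :: "'a topology \<Rightarrow> bool" where
  "compact_Hausdorff X \<equiv> compact_space X \<and> Hausdorff_space X"

(* A definition in HOL cannot quantify over types, so "for all compact Hausdorff spaces X, Y"
   must range over the topologies on one fixed type. For P :: 'a topology the type
   'a set set is large enough: lemma projective_space_lift shows that the lifting property
   then holds for compact Hausdorff spaces X :: 'b topology and Y :: 'c topology over
   arbitrary types. *)
definition projective_space :: "'a topology \<Rightarrow> bool" where
  "projective_space P \<longleftrightarrow> compact_Hausdorff P \<and>
     (\<forall>(X :: 'a set set topology) (Y :: 'a set set topology) h f.
        compact_Hausdorff X \<and> compact_Hausdorff Y \<and>
        continuous_map Y X h \<and> continuous_map P X f \<and> h ` topspace Y = topspace X \<longrightarrow>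
        (\<exists>r. continuous_map P Y r \<and> (\<forall>p\<in>topspace P. h (r p) = f p)))"

definition cover_of :: "'b topology \<Rightarrow> 'a topology \<Rightarrow> ('a \<Rightarrow> 'b) \<Rightarrow> bool" where
  "cover_of X C f \<longleftrightarrow>
     compact_Hausdorff C \<and> continuous_map C X f \<and> f ` topspace C = topspace X"

(* The test spaces Y are taken over the type of points of C; by lemma essential_cover_ofD
   this again yields the condition for compact Hausdorff spaces Y over every type. *)
definition essential_cover_of :: "'b topology \<Rightarrow> 'a topology \<Rightarrow> ('a \<Rightarrow> 'b) \<Rightarrow> bool" where
  "essential_cover_of X C f \<longleftrightarrow> cover_of X C f \<and>
     (\<forall>(Y :: 'a topology) h.
        compact_Hausdorff Y \<and> continuous_map Y C h \<and> f ` (h ` topspace Y) = topspace X \<longrightarrow>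
        h ` topspace Y = topspace C)"

definition rigid_cover_of :: "'b topology \<Rightarrow> 'a topology \<Rightarrow> ('a \<Rightarrow> 'b) \<Rightarrow> bool" where
  "rigid_cover_of X C f \<longleftrightarrow> cover_of X C f \<and>
     (\<forall>h. continuous_map C C h \<and> (\<forall>c\<in>topspace C. f (h c) = f c) \<longrightarrow>
        (\<forall>c\<in>topspace C. h c = c))"

lemma essential_cover_ofD:
  fixes Y :: "'c topology"
  assumes "essential_cover_of X C f" and "compact_Hausdorff Y"
    and "continuous_map Y C h" and "f ` (h ` topspace Y) = topspace X"
  shows "h ` topspace Y = topspace C"
proof -
  let ?K = "h ` topspace Y"
  have C: "compact_Hausdorff C"
    using assms(1) by (simp add: essential_cover_of_def cover_of_def)
  have sub: "?K \<subseteq> topspace C"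
    using assms(3) by (rule continuous_map_image_subset_topspace)
  have "compactin C ?K"
    using assms(2,3) by (auto intro: image_compactin simp: compact_space_def)
  then have K: "compact_Hausdorff (subtopology C ?K)"
    using C by (simp add: compact_space_subtopology Hausdorff_space_subtopology)
  have ts: "topspace (subtopology C ?K) = ?K"
    using sub by (rule topspace_subtopology_subset)
  have "continuous_map (subtopology C ?K) C id"
    by (simp add: continuous_map_from_subtopology)
  with K ts assms(1,4) show ?thesis
    unfolding essential_cover_of_def by (metis id_apply image_id)
qed

lemma homeomorphic_copy:
  assumes "inj_on \<phi> (topspace T)"
  obtains T' where "homeomorphic_map T T' \<phi>"
proof
  let ?\<psi> = "inv_into (topspace T) \<phi>"
  let ?T' = "pullback_topology (\<phi> ` topspace T) ?\<psi> T"
  have inv: "?\<psi> (\<phi> x) = x" if "x \<in> topspace T" for x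
    using assms that by simp
  have "continuous_map T ?T' \<phi>"
  proof (rule continuous_map_pullback')
    show "continuous_map T T (?\<psi> \<circ> \<phi>)"
      by (rule continuous_map_eq[OF continuous_map_id]) (simp add: inv)
    show "topspace T \<subseteq> \<phi> -` \<phi> ` topspace T" by auto
  qed
  moreover have "continuous_map ?T' T ?\<psi>"
    using continuous_map_pullback[of T T id "\<phi> ` topspace T" ?\<psi>] by simp
  moreover have "\<phi> (?\<psi> y) = y" if "y \<in> topspace ?T'" for y
    using that by (auto simp: topspace_pullback_topology f_inv_into_f)
  ultimately have "homeomorphic_maps T ?T' \<phi> ?\<psi>"
    by (simp add: homeomorphic_maps_def inv)
  then show "homeomorphic_map T ?T' \<phi>"
    by (auto simp: homeomorphic_map_maps)
qed

lemma projective_space_lift: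
  fixes P :: "'a topology" and X :: "'b topology" and Y :: "'c topology"
  assumes P: "projective_space P"
    and X: "compact_Hausdorff X" and Y: "compact_Hausdorff Y"
    and h: "continuous_map Y X h" and f: "continuous_map P X f"
    and onto: "h ` topspace Y = topspace X"
  shows "\<exists>r. continuous_map P Y r \<and> (\<forall>p\<in>topspace P. h (r p) = f p)"
proof -
  have PP: "compact_Hausdorff P"
    using P by (simp add: projective_space_def)
  have "\<exists>y\<in>topspace Y. h y = f p" if "p \<in> topspace P" for p
    using that continuous_map_image_subset_topspace[OF f] onto by (metis imageE image_subset_iff)
  then obtain s where s: "\<And>p. p \<in> topspace P \<Longrightarrow> s p \<in> topspace Y \<and> h (s p) = f p"
    by metis
  define Z where "Z = prod_topology P Y"
  define g where "g p = (p, s p)" for p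
  define D where "D = g ` topspace P"
  define E where "E = Z closure_of D"
  define T where "T = subtopology Z E"
  have DZ: "D \<subseteq> topspace Z"
    using s by (auto simp: D_def g_def Z_def)
  have EZ: "E \<subseteq> topspace Z"
    by (simp add: E_def closure_of_subset_topspace)
  have ZZ: "compact_Hausdorff Z"
    using PP Y by (simp add: Z_def compact_space_prod_topology Hausdorff_space_prod_topology)
  have TT: "compact_Hausdorff T"
    using ZZ unfolding T_def E_def
    by (simp add: Hausdorff_space_subtopology closedin_compact_space compact_space_subtopology)
  have tT: "topspace T = E"
    unfolding T_def using EZ by (rule topspace_subtopology_subset)
  have "closedin Z {z \<in> topspace Z. (f \<circ> fst) z = (h \<circ> snd) z}"
    using X unfolding Z_def
    by (intro closedin_continuous_maps_eq[of X] continuous_map_compose[OF continuous_map_fst f]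
          continuous_map_compose[OF continuous_map_snd h]) simp
  moreover have "D \<subseteq> {z \<in> topspace Z. (f \<circ> fst) z = (h \<circ> snd) z}"
    using DZ s by (auto simp: D_def g_def)
  ultimately have Eeq: "f (fst z) = h (snd z)" if "z \<in> E" for z
    using closure_of_minimal that unfolding E_def by fastforce
  have fstT: "continuous_map T P fst" and sndT: "continuous_map T Y snd"
    unfolding T_def Z_def
    by (simp_all add: continuous_map_from_subtopology continuous_map_fst continuous_map_snd)
  have "D \<subseteq> E"
    using DZ by (simp add: E_def closure_of_subset)
  then have "fst ` D \<subseteq> fst ` topspace T"
    unfolding tT by (rule image_mono)
  moreover have "fst ` D = topspace P"
    by (auto simp: D_def g_def image_image)
  ultimately have fst_onto: "fst ` topspace T = topspace P"
    using continuous_map_image_subset_topspace[OF fstT] by blast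

  define \<phi> where "\<phi> z = {A. A \<subseteq> topspace P \<and> z \<in> Z closure_of (g ` A)}" for z
  have "inj_on \<phi> (topspace T)"
  proof (rule inj_onI, rule ccontr)
    fix z z' assume z: "z \<in> topspace T" "z' \<in> topspace T" "\<phi> z = \<phi> z'" "z \<noteq> z'"
    have zE: "z \<in> E" "z' \<in> E" using z tT by auto
    then have "z \<in> topspace Z" "z' \<in> topspace Z" using EZ by auto
    with ZZ z(4) obtain U V where UV: "openin Z U" "openin Z V" "z \<in> U" "z' \<in> V" "disjnt U V"
      unfolding Hausdorff_space_def by metis
    define A where "A = {p \<in> topspace P. g p \<in> U}"
    have "z \<in> Z closure_of (g ` A)"
      unfolding in_closure_of
    proof (intro conjI allI impI)
      show "z \<in> topspace Z" by fact
      fix W assume "z \<in> W \<and> openin Z W"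
      then have "z \<in> W \<inter> U" "openin Z (W \<inter> U)" using UV by auto
      then obtain d where "d \<in> D" "d \<in> W \<inter> U"
        using zE(1) unfolding E_def in_closure_of by blast
      then show "\<exists>y. y \<in> g ` A \<and> y \<in> W"
        unfolding D_def A_def by auto
    qed
    then have "A \<in> \<phi> z" by (auto simp: \<phi>_def A_def)
    then have "z' \<in> Z closure_of (g ` A)" using z(3) by (auto simp: \<phi>_def)
    then obtain y where "y \<in> g ` A" "y \<in> V"
      using UV unfolding in_closure_of by blast
    then show False
      using UV(5) by (auto simp: A_def disjnt_def)
  qed
  then obtain T' where T': "homeomorphic_map T T' \<phi>"
    by (rule homeomorphic_copy)
  then obtain \<psi> where \<psi>: "homeomorphic_maps T T' \<phi> \<psi>"
    by (auto simp: homeomorphic_map_maps)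
  define \<iota> :: "'a \<Rightarrow> 'a set set" where "\<iota> p = {{p}}" for p
  have "inj_on \<iota> (topspace P)" by (simp add: \<iota>_def inj_on_def)
  then obtain P' where P': "homeomorphic_map P P' \<iota>"
    by (rule homeomorphic_copy)

  have cT': "compact_Hausdorff T'"
    using TT T' homeomorphic_map_imp_homeomorphic_space homeomorphic_compact_space
      homeomorphic_Hausdorff_space by metis
  have cP': "compact_Hausdorff P'"
    using PP P' homeomorphic_map_imp_homeomorphic_space homeomorphic_compact_space
      homeomorphic_Hausdorff_space by metis
  have \<iota>c: "continuous_map P P' \<iota>" and \<iota>onto: "\<iota> ` topspace P = topspace P'"
    using P' by (auto simp: homeomorphic_eq_everything_map)
  have \<psi>c: "continuous_map T' T \<psi>"
    using \<psi> by (simp add: homeomorphic_maps_def)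
  have "\<psi> ` topspace T' = topspace T"
    using \<psi> by (meson homeomorphic_imp_surjective_map homeomorphic_maps_map)
  then have onto': "(\<iota> \<circ> fst \<circ> \<psi>) ` topspace T' = topspace P'"
    using fst_onto \<iota>onto by (simp only: image_comp[symmetric])
  have cont': "continuous_map T' P' (\<iota> \<circ> fst \<circ> \<psi>)"
    using \<psi>c fstT \<iota>c by (auto intro: continuous_map_compose)
  obtain r where r: "continuous_map P T' r" "\<And>p. p \<in> topspace P \<Longrightarrow> (\<iota> \<circ> fst \<circ> \<psi>) (r p) = \<iota> p"
    using P cT' cP' cont' \<iota>c onto' unfolding projective_space_def by metis
  have \<psi>r: "continuous_map P T (\<psi> \<circ> r)"
    using r(1) \<psi>c by (rule continuous_map_compose)
  show ?thesis
  proof (intro exI conjI ballI)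
    show "continuous_map P Y (snd \<circ> (\<psi> \<circ> r))"
      using \<psi>r sndT by (rule continuous_map_compose)
    fix p assume p: "p \<in> topspace P"
    have "\<psi> (r p) \<in> E"
      using continuous_map_image_subset_topspace[OF \<psi>r] p tT by auto
    then have "h (snd (\<psi> (r p))) = f (fst (\<psi> (r p)))" by (simp add: Eeq)
    also have "fst (\<psi> (r p)) = p" using r(2)[OF p] by (simp add: \<iota>_def)
    finally show "h ((snd \<circ> (\<psi> \<circ> r)) p) = f p" by simp
  qed
qed

end

(* A continuous self-map h over X that moves a point c maps a small neighbourhood U of c into its
   complement, so the complement of U still maps onto X. Hence an essential cover is rigid.
   Minimality of C says that C is an essential cover. Lifting f along the restriction of f to C
   gives a map P -> C over X, which by rigidity is a retraction, so C is projective. Two projective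
   rigid covers lift to each other, and the two compositions are identities by rigidity. *)

theory Submission
  imports Defs
begin

lemma rigid_cover_ofD:
  assumes "rigid_cover_of X C f" and "continuous_map C C h"
    and "\<And>c. c \<in> topspace C \<Longrightarrow> f (h c) = f c" and "c \<in> topspace C"
  shows "h c = c"
  using assms by (simp add: rigid_cover_of_def)

lemma essential_cover_of_imp_rigid_cover_of:
  assumes ess: "essential_cover_of X C f"
  shows "rigid_cover_of X C f"
  unfolding rigid_cover_of_def
proof (intro conjI allI impI ballI)
  show cov: "cover_of X C f"
    using ess by (simp add: essential_cover_of_def)
  fix h c
  assume h: "continuous_map C C h \<and> (\<forall>c\<in>topspace C. f (h c) = f c)" and c: "c \<in> topspace C"
  show "h c = c"
  proof (rule ccontr)
    assume "h c \<noteq> c"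
    moreover have maps: "h x \<in> topspace C" if "x \<in> topspace C" for x
      using h that continuous_map_image_subset_topspace by blast
    ultimately obtain U V where UV: "openin C U" "openin C V" "c \<in> U" "h c \<in> V" "disjnt U V"
      using cov c unfolding cover_of_def Hausdorff_space_def by metis
    \<comment> \<open>\<open>W\<close> is a neighbourhood of \<open>c\<close> with \<open>h\<close>
      mapping \<open>W\<close> into the complement of \<open>W\<close>: points of \<open>W\<close>
      go into \<open>V\<close>, which misses \<open>U\<close> and hence \<open>W\<close>.\<close>
    define W where "W = U \<inter> {x \<in> topspace C. h x \<in> V}"
    have "openin C W"
      unfolding W_def using h UV by (auto intro: openin_continuous_map_preimage)
    have "c \<in> W" using UV c by (simp add: W_def)
    let ?K = "topspace C - W"
    have clK: "closedin C ?K" using \<open>openin C W\<close> by blast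
    have K: "compact_Hausdorff (subtopology C ?K)"
      using cov clK by (simp add: cover_of_def Hausdorff_space_subtopology
          closedin_compact_space compact_space_subtopology)
    \<comment> \<open>A point \<open>x\<close> of \<open>W\<close> can be replaced by
      \<open>h x\<close>, which lies outside \<open>W\<close> and has the same image under
      \<open>f\<close>. So removing \<open>W\<close> loses no value of \<open>f\<close>.\<close>
    have "f x \<in> f ` ?K" if "x \<in> topspace C" for x
    proof (cases "x \<in> W")
      case True
      then have "h x \<in> ?K"
        using UV(5) maps[OF that] by (auto simp: W_def disjnt_def)
      then show ?thesis using h that by (metis imageI)
    qed (use that in auto)
    then have "f ` topspace C \<subseteq> f ` ?K" by blast
    then have "f ` ?K = topspace X"
      using cov unfolding cover_of_def by blast
    \<comment> \<open>The inclusion of \<open>?K\<close> into \<open>C\<close> serves as the test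
      map for essentiality, which forces \<open>?K\<close> to be all of \<open>C\<close> although it
      omits \<open>c\<close>.\<close>
    then have "id ` topspace (subtopology C ?K) = topspace C"
      using K by (intro essential_cover_ofD[OF ess K])
        (auto simp: continuous_map_from_subtopology Int_absorb1)
    then show False using \<open>c \<in> W\<close> c by auto
  qed
qed

text \<open>Composing with the retraction \<open>r\<close> extends any map on \<open>C\<close> to
  all of \<open>P\<close>. The extension lifts because \<open>P\<close> is projective, and
  restricting its lift to \<open>C\<close> lifts the original map, since \<open>r\<close> fixes
  \<open>C\<close> pointwise.\<close>

lemma projective_space_retract:
  assumes P: "projective_space P" and r: "continuous_map P (subtopology P C) r"
    and C: "compactin P C" and fix_C: "\<And>c. c \<in> C \<Longrightarrow> r c = c"
  shows "projective_space (subtopology P C)"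
  unfolding projective_space_def
proof (intro conjI allI impI)
  show "compact_space (subtopology P C)" "Hausdorff_space (subtopology P C)"
    using P C by (simp_all add: projective_space_def compact_space_subtopology
        Hausdorff_space_subtopology)
  have sub: "C \<subseteq> topspace P" using C by (rule compactin_subset_topspace)
  fix X Y :: "'a set set topology" and h g
  assume a: "compact_Hausdorff X \<and> compact_Hausdorff Y \<and> continuous_map Y X h \<and>
    continuous_map (subtopology P C) X g \<and> h ` topspace Y = topspace X"
  then have "continuous_map P X (g \<circ> r)" by (intro continuous_map_compose[OF r]) simp
  with a obtain s where s: "continuous_map P Y s" "\<forall>p\<in>topspace P. h (s p) = (g \<circ> r) p"
    using projective_space_lift[OF P] by metis
  show "\<exists>s. continuous_map (subtopology P C) Y s \<and>
      (\<forall>p\<in>topspace (subtopology P C). h (s p) = g p)"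
  proof (intro exI conjI ballI)
    show "continuous_map (subtopology P C) Y s"
      using s(1) by (rule continuous_map_from_subtopology)
    fix p assume "p \<in> topspace (subtopology P C)"
    then have "p \<in> topspace P" "p \<in> C" by auto
    then show "h (s p) = g p" using s(2) fix_C by (metis comp_apply)
  qed
qed

text \<open>Since \<open>f\<close> is onto, \<open>g\<close> can be lifted along it. The lift is a
  morphism of covers over \<open>X\<close>, available even when \<open>Q\<close> and
  \<open>C\<close> have points of different types.\<close>

lemma projective_cover_lift:
  assumes "projective_space Q" and "compact_Hausdorff X"
    and "cover_of X Q g" and "cover_of X C f"
  obtains r where "continuous_map Q C r" "\<And>q. q \<in> topspace Q \<Longrightarrow> f (r q) = g q"
  using projective_space_lift[of Q X C f g] assms unfolding cover_of_def by metis

lemma rigid_projective_covers_homeomorphic: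
  assumes X: "compact_Hausdorff X"
    and C: "projective_space C" "rigid_cover_of X C f"
    and D: "projective_space D" "rigid_cover_of X D g"
  obtains h where "homeomorphic_map C D h" "\<And>c. c \<in> topspace C \<Longrightarrow> g (h c) = f c"
proof -
  have cov: "cover_of X C f" "cover_of X D g"
    using C D by (simp_all add: rigid_cover_of_def)
  obtain h where h: "continuous_map C D h" "\<And>c. c \<in> topspace C \<Longrightarrow> g (h c) = f c"
    using projective_cover_lift[OF C(1) X cov] by blast
  obtain k where k: "continuous_map D C k" "\<And>d. d \<in> topspace D \<Longrightarrow> f (k d) = g d"
    using projective_cover_lift[OF D(1) X cov(2,1)] by blast
  have hD: "h c \<in> topspace D" if "c \<in> topspace C" for c
    using h(1) that continuous_map_image_subset_topspace by blast
  have kC: "k d \<in> topspace C" if "d \<in> topspace D" for d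
    using k(1) that continuous_map_image_subset_topspace by blast
  \<comment> \<open>Both composites lie over \<open>X\<close>, as
    \<open>f (k (h c)) = g (h c) = f c\<close> and symmetrically, so rigidity of each cover
    applies.\<close>
  have "(k \<circ> h) c = c" if "c \<in> topspace C" for c
    using that
    by (rule rigid_cover_ofD[OF C(2) continuous_map_compose[OF h(1) k(1)], rotated]) (simp add: h(2) k(2) hD)
  moreover have "(h \<circ> k) d = d" if "d \<in> topspace D" for d
    using that
    by (rule rigid_cover_ofD[OF D(2) continuous_map_compose[OF k(1) h(1)], rotated]) (simp add: h(2) k(2) kC)
  ultimately have "homeomorphic_maps C D h k"
    using h(1) k(1) by (simp add: homeomorphic_maps_def)
  then show ?thesis using that h(2) by (auto simp: homeomorphic_map_maps)
qed

theorem theorem2p16: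
  fixes X :: "'x topology" and P :: "'p topology" and f :: "'p \<Rightarrow> 'x" and C :: "'p set"
  assumes "compact_Hausdorff X"
    and "cover_of X P f" and "projective_space P"
    and "compactin P C" and "f ` C = topspace X"
    and minimal: "\<And>D. compactin P D \<Longrightarrow> f ` D = topspace X \<Longrightarrow> D \<subseteq> C \<Longrightarrow> D = C"
  shows "rigid_cover_of X (subtopology P C) f
    \<and> essential_cover_of X (subtopology P C) f
    \<and> projective_space (subtopology P C)
    \<and> (\<forall>(C' :: 'c topology) (f' :: 'c \<Rightarrow> 'x).
         cover_of X C' f' \<and> projective_space C' \<and>
         (rigid_cover_of X C' f' \<or> essential_cover_of X C' f') \<longrightarrow>
         (\<exists>h. homeomorphic_map (subtopology P C) C' h \<and> (\<forall>c\<in>C. f' (h c) = f c)))"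
proof -
  let ?S = "subtopology P C"
  have sub: "C \<subseteq> topspace P" using assms(4) by (rule compactin_subset_topspace)
  then have tS: "topspace ?S = C" by (rule topspace_subtopology_subset)
  have cov: "cover_of X ?S f"
    using assms(2,4,5) tS by (simp add: cover_of_def compact_space_subtopology
        Hausdorff_space_subtopology continuous_map_from_subtopology)
  have ess: "essential_cover_of X ?S f"
    unfolding essential_cover_of_def
  proof (intro conjI allI impI cov)
    fix Y :: "'p topology" and h
    assume a: "compact_Hausdorff Y \<and> continuous_map Y ?S h \<and> f ` h ` topspace Y = topspace X"
    \<comment> \<open>The image of a test space is a compact subset of \<open>C\<close> that
      \<open>f\<close> maps onto \<open>X\<close>, so minimality makes it equal to
      \<open>C\<close>.\<close>
    then have "compactin ?S (h ` topspace Y)"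
      by (auto intro: image_compactin simp: compact_space_def)
    with a show "h ` topspace Y = topspace ?S"
      unfolding tS by (intro minimal) (auto simp: compactin_subtopology)
  qed
  then have rig: "rigid_cover_of X ?S f"
    by (rule essential_cover_of_imp_rigid_cover_of)
  obtain r where r: "continuous_map P ?S r" "\<And>p. p \<in> topspace P \<Longrightarrow> f (r p) = f p"
    using projective_cover_lift[OF assms(3,1,2) cov] by blast
  \<comment> \<open>Restricted to \<open>C\<close>, the lift \<open>r\<close> is a continuous
    self-map of \<open>C\<close> over \<open>X\<close>, to which rigidity applies.\<close>
  have "r c = c" if "c \<in> C" for c
    using rig continuous_map_from_subtopology[OF r(1)]
    by (rule rigid_cover_ofD) (use r(2) sub tS that in auto)
  then have proj: "projective_space ?S"
    using projective_space_retract[OF assms(3) r(1) assms(4)] by blast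
  \<comment> \<open>An essential \<open>C'\<close> is also rigid, so both alternatives reduce to
    comparing two rigid projective covers.\<close>
  have "\<exists>h. homeomorphic_map ?S C' h \<and> (\<forall>c\<in>C. f' (h c) = f c)"
    if "projective_space C'" "rigid_cover_of X C' f' \<or> essential_cover_of X C' f'"
    for C' :: "'c topology" and f'
    using rigid_projective_covers_homeomorphic[OF assms(1) proj rig that(1)]
      that(2) essential_cover_of_imp_rigid_cover_of tS by metis
  with rig ess proj show ?thesis by blast
qed

end
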